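(* Let $B\ge 1$, let $x_{\rm tr}\in\mathbb{C}^B\setminus\{0\}$ be a fixed training vector, let $\sigma_x^2,\sigma_w^2>0$, and let the channel $h$ be a complex random variable with known prior distribution, $E[h]=0$ and $0<E[|h|^2]<\infty$. Then neither the MVU filter $$f_{\rm MVU}=\frac{x_{\rm tr}}{\|x_{\rm tr}\|^2}$$ nor the MMSE filter $$f_{\rm MMSE}=\frac{E[|h|^2]\,x_{\rm tr}}{E[|h|^2]\,\|x_{\rm tr}\|^2+\sigma_w^2}$$ is an optimal channel estimator for the task of minimizing $\left[\mathrm{MSE}_x^{rc}(\mathrm{ZF})\right]_0$; that is, neither of them minimizes $f\mapsto\left[\mathrm{MSE}_x^{rc}(\mathrm{ZF})\right]_0(f)$ over $f\in\mathbb{C}^B\setminus\{0\}$.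
   Context: Training model: $y_{\rm tr}=h\,x_{\rm tr}+w_{\rm tr}$, where $w_{\rm tr}\in\mathbb{C}^B$ is independent of $h$ and has i.i.d. circularly symmetric complex Gaussian entries of mean $0$ and variance $\sigma_w^2$. A linear channel estimator is determined by a filter $f\in\mathbb{C}^B$ through $\hat h=f^H y_{\rm tr}$. The data symbols have mean zero and power $\sigma_x^2$. The zeroth order symbol estimate MSE of the zero-forcing equalizer for a random channel is defined, with $E_h$ the expectation over $h$ and the inner $E$ over the noise, as $$\left[\mathrm{MSE}_x^{rc}(\mathrm{ZF})\right]_0(f)=\frac{E_h\big[E[|\hat h-h|^2]\big]}{E_h\big[E[|\hat h|^2]\big]}\,\sigma_x^2+\frac{\sigma_w^2}{E_h\big[E[|\hat h|^2]\big]} =\sigma_x^2\,\frac{E[|h|^2]\,|f^Hx_{\rm tr}-1|^2+\sigma_w^2\|f\|^2+\sigma_w^2/\sigma_x^2}{E[|h|^2]\,|f^Hx_{\rm tr}|^2+\sigma_w^2\|f\|^2}.$$ *)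

theory Defs
  imports "HOL-Probability.Probability"
begin

definition herm :: "complex ^ 'b \<Rightarrow> complex ^ 'b \<Rightarrow> complex" where
  "herm f y = (\<Sum>i\<in>UNIV. cnj (f $ i) * y $ i)"

text \<open>Circular symmetry of a Gaussian with (complex) variance \<open>v\<close>: independent real and imaginary
  parts, each centred with variance \<open>v / 2\<close>.\<close>

definition circ_gaussian :: "'w measure \<Rightarrow> real \<Rightarrow> ('w \<Rightarrow> complex) \<Rightarrow> bool" where
  "circ_gaussian M v Z \<longleftrightarrow>
     distributed M lborel (\<lambda>\<omega>. Re (Z \<omega>)) (normal_density 0 (sqrt (v / 2))) \<and>
     distributed M lborel (\<lambda>\<omega>. Im (Z \<omega>)) (normal_density 0 (sqrt (v / 2))) \<and>
     prob_space.indep_var M borel (\<lambda>\<omega>. Re (Z \<omega>)) borel (\<lambda>\<omega>. Im (Z \<omega>))"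

definition iid_circ_gaussian :: "'w measure \<Rightarrow> real \<Rightarrow> ('w \<Rightarrow> complex ^ 'b) \<Rightarrow> bool" where
  "iid_circ_gaussian M v w \<longleftrightarrow>
     prob_space.indep_vars M (\<lambda>_. borel) (\<lambda>i \<omega>. w \<omega> $ i) UNIV \<and>
     (\<forall>i. circ_gaussian M v (\<lambda>\<omega>. w \<omega> $ i))"

definition y_tr :: "complex ^ 'b \<Rightarrow> complex \<Rightarrow> complex ^ 'b \<Rightarrow> complex ^ 'b" where
  "y_tr x c n = c *s x + n"

definition h_hat :: "complex ^ 'b \<Rightarrow> complex ^ 'b \<Rightarrow> complex \<Rightarrow> complex ^ 'b \<Rightarrow> complex" where
  "h_hat x f c n = herm f (y_tr x c n)"

text \<open>\<open>H\<close> is the prior law of the channel and \<open>N\<close> the law of the training noise. The inner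
  expectation is over the noise at a fixed channel value; since channel and noise are independent,
  the law of the noise is not affected by fixing the channel.\<close>

definition mean_sq_error ::
    "complex measure \<Rightarrow> (complex ^ 'b) measure \<Rightarrow> complex ^ 'b \<Rightarrow> complex ^ 'b \<Rightarrow> real" where
  "mean_sq_error H N x f = (\<integral>c. (\<integral>n. (cmod (h_hat x f c n - c))\<^sup>2 \<partial>N) \<partial>H)"

definition mean_sq_estimate ::
    "complex measure \<Rightarrow> (complex ^ 'b) measure \<Rightarrow> complex ^ 'b \<Rightarrow> complex ^ 'b \<Rightarrow> real" where
  "mean_sq_estimate H N x f = (\<integral>c. (\<integral>n. (cmod (h_hat x f c n))\<^sup>2 \<partial>N) \<partial>H)"

text \<open>The parameters \<open>vx\<close> and \<open>vw\<close> are the symbol power and the noise variance (already squared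
  quantities).\<close>

definition MSE_rc_ZF0 ::
    "complex measure \<Rightarrow> (complex ^ 'b) measure \<Rightarrow> complex ^ 'b \<Rightarrow> real \<Rightarrow> real \<Rightarrow>
     complex ^ 'b \<Rightarrow> real" where
  "MSE_rc_ZF0 H N x vx vw f =
     mean_sq_error H N x f / mean_sq_estimate H N x f * vx + vw / mean_sq_estimate H N x f"

definition f_MVU :: "complex ^ 'b \<Rightarrow> complex ^ 'b" where
  "f_MVU x = (1 / (norm x)\<^sup>2) *\<^sub>R x"

definition f_MMSE :: "real \<Rightarrow> real \<Rightarrow> complex ^ 'b \<Rightarrow> complex ^ 'b" where
  "f_MMSE Eh2 vw x = (Eh2 / (Eh2 * (norm x)\<^sup>2 + vw)) *\<^sub>R x"

end

theory Submission imports Defs begin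

text \<open>On the ray \<open>f = a x\<close> with \<open>a > 0\<close> real, put \<open>P = E|h|\<^sup>2\<close>, \<open>s = \<parallel>x\<parallel>\<^sup>2\<close>, \<open>q = vw / vx\<close> and \<open>u = 1 / a\<close>.
  Subtracting the denominator from the numerator, the objective becomes
  \<open>vx (1 + ((P + q) u\<^sup>2 - 2 P s u) / (s (P s + vw)))\<close>, a quadratic in \<open>u\<close> whose only minimizer is
  \<open>u = P s / (P + q)\<close>. The MVU filter has \<open>u = s\<close> and the MMSE filter has \<open>u = s + vw / P\<close>; both are
  strictly larger, so both filters are beaten by \<open>((P + q) / (P s)) x\<close>.\<close>

lemma power2_norm_vec: "(norm x)\<^sup>2 = (\<Sum>i\<in>UNIV. (norm (x $ i))\<^sup>2)"
  by (simp add: norm_vec_def L2_set_def sum_nonneg)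

section \<open>Second moments of circular Gaussian noise\<close>

context prob_space
begin

lemma normal_second_moment:
  assumes "0 < \<sigma>" and D: "distributed M lborel X (normal_density 0 \<sigma>)"
  shows "integrable M X" "expectation X = 0"
    and "integrable M (\<lambda>\<omega>. (X \<omega>)\<^sup>2)" "expectation (\<lambda>\<omega>. (X \<omega>)\<^sup>2) = \<sigma>\<^sup>2"
proof -
  show "integrable M X"
    using distributed_integrable_var[OF D] integrable_normal_moment[OF assms(1), of 0 1] by simp
  show mean: "expectation X = 0"
    by (rule normal_distributed_expectation[OF assms])
  show "integrable M (\<lambda>\<omega>. (X \<omega>)\<^sup>2)"
    using distributed_integrable[OF D, of "\<lambda>x. x\<^sup>2"] integrable_normal_moment[OF assms(1), of 0 2]
    by simp
  show "expectation (\<lambda>\<omega>. (X \<omega>)\<^sup>2) = \<sigma>\<^sup>2"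
    using normal_distributed_variance[OF assms] mean by simp
qed

text \<open>Linearity reduces everything to two real normal variables of variance
  \<open>v / 2\<close>, whose second moments add up to \<open>v\<close>.\<close>

lemma circ_gaussian_moments:
  assumes Z: "circ_gaussian M v Z" and v: "0 < v"
  shows "integrable M Z" "expectation Z = 0"
    and "integrable M (\<lambda>\<omega>. (cmod (Z \<omega>))\<^sup>2)" "expectation (\<lambda>\<omega>. (cmod (Z \<omega>))\<^sup>2) = v"
proof -
  have \<sigma>: "0 < sqrt (v / 2)" using v by simp
  note re = normal_second_moment[OF \<sigma>, of "\<lambda>\<omega>. Re (Z \<omega>)"]
  note im = normal_second_moment[OF \<sigma>, of "\<lambda>\<omega>. Im (Z \<omega>)"]
  note D = Z[unfolded circ_gaussian_def]
  have Z_eq: "Z = (\<lambda>\<omega>. complex_of_real (Re (Z \<omega>)) + \<i> * complex_of_real (Im (Z \<omega>)))"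
    by (simp add: complex_eq[symmetric])
  show "integrable M Z"
    by (subst Z_eq, intro Bochner_Integration.integrable_add integrable_mult_right integrable_of_real)
      (use re im D in auto)
  have "expectation Z = expectation (\<lambda>\<omega>. complex_of_real (Re (Z \<omega>)))
      + expectation (\<lambda>\<omega>. \<i> * complex_of_real (Im (Z \<omega>)))"
    by (subst Z_eq, intro Bochner_Integration.integral_add integrable_mult_right integrable_of_real)
      (use re im D in auto)
  then show "expectation Z = 0"
    using re im D by simp
  show "integrable M (\<lambda>\<omega>. (cmod (Z \<omega>))\<^sup>2)" "expectation (\<lambda>\<omega>. (cmod (Z \<omega>))\<^sup>2) = v"
    using re im D v by (simp_all add: cmod_power2)
qed

text \<open>The noise covariance is \<open>v\<close> times the identity: off the diagonal,
  independence factorizes the expectation and the zero means kill it; on the diagonal the product is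
  a squared modulus.\<close>

lemma iid_circ_gaussian_cross_moment:
  assumes w: "iid_circ_gaussian M v w" and v: "0 < v"
  shows "integrable M (\<lambda>\<omega>. w \<omega> $ i * cnj (w \<omega> $ j))"
    and "expectation (\<lambda>\<omega>. w \<omega> $ i * cnj (w \<omega> $ j)) = (if i = j then complex_of_real v else 0)"
proof -
  note indep = w[unfolded iid_circ_gaussian_def, THEN conjunct1]
  have mom: "integrable M (\<lambda>\<omega>. w \<omega> $ k)" "expectation (\<lambda>\<omega>. w \<omega> $ k) = 0"
    "integrable M (\<lambda>\<omega>. (cmod (w \<omega> $ k))\<^sup>2)" "expectation (\<lambda>\<omega>. (cmod (w \<omega> $ k))\<^sup>2) = v" for k
    using circ_gaussian_moments[OF _ v] w unfolding iid_circ_gaussian_def by auto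
  have "integrable M (\<lambda>\<omega>. w \<omega> $ i * cnj (w \<omega> $ j)) \<and>
      expectation (\<lambda>\<omega>. w \<omega> $ i * cnj (w \<omega> $ j)) = (if i = j then complex_of_real v else 0)"
  proof (cases "i = j")
    case True
    then show ?thesis
      using mom(3,4)[of j] by (simp add: complex_norm_square[symmetric] del: of_real_power)
  next
    case False
    have "indep_var borel ((\<lambda>z. z) \<circ> (\<lambda>\<omega>. w \<omega> $ i)) borel (cnj \<circ> (\<lambda>\<omega>. w \<omega> $ j))"
    proof (rule indep_var_compose)
      \<comment> \<open>Independence of the whole family yields that of a pair by restricting to the
        disjoint index sets \<open>{i}\<close> and \<open>{j}\<close> and then reading off the
        single coordinate.\<close>
      have "indep_var borel ((\<lambda>p. p i) \<circ> (\<lambda>\<omega>. restrict (\<lambda>k. w \<omega> $ k) {i}))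
          borel ((\<lambda>p. p j) \<circ> (\<lambda>\<omega>. restrict (\<lambda>k. w \<omega> $ k) {j}))"
        by (rule indep_var_compose[OF indep_var_restrict[OF indep]]) (use False in auto)
      then show "indep_var borel (\<lambda>\<omega>. w \<omega> $ i) borel (\<lambda>\<omega>. w \<omega> $ j)"
        by (simp add: comp_def)
    qed (auto intro: borel_measurable_continuous_onI continuous_intros)
    then have iv: "indep_var borel (\<lambda>\<omega>. w \<omega> $ i) borel (\<lambda>\<omega>. cnj (w \<omega> $ j))"
      by (simp add: comp_def)
    have cnj_int: "integrable M (\<lambda>\<omega>. cnj (w \<omega> $ j))"
      using mom(1)[of j] by simp
    show ?thesis
      using indep_var_integrable[OF iv mom(1) cnj_int]
        indep_var_lebesgue_integral[OF iv mom(1) cnj_int] mom(2)[of i] False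
      by simp
  qed
  then show "integrable M (\<lambda>\<omega>. w \<omega> $ i * cnj (w \<omega> $ j))"
    and "expectation (\<lambda>\<omega>. w \<omega> $ i * cnj (w \<omega> $ j)) = (if i = j then complex_of_real v else 0)"
    by auto
qed

text \<open>Expanding the squared modulus into a double sum, only the diagonal of the covariance
  survives.\<close>

lemma herm_noise_moments:
  fixes f :: "complex ^ 'b"
  assumes w: "iid_circ_gaussian M v w" and v: "0 < v"
  shows "integrable M (\<lambda>\<omega>. herm f (w \<omega>))" "expectation (\<lambda>\<omega>. herm f (w \<omega>)) = 0"
    and "integrable M (\<lambda>\<omega>. (cmod (herm f (w \<omega>)))\<^sup>2)"
    and "expectation (\<lambda>\<omega>. (cmod (herm f (w \<omega>)))\<^sup>2) = v * (norm f)\<^sup>2"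
proof -
  have mom: "integrable M (\<lambda>\<omega>. w \<omega> $ k)" "expectation (\<lambda>\<omega>. w \<omega> $ k) = 0" for k
    using circ_gaussian_moments[OF _ v] w unfolding iid_circ_gaussian_def by auto
  note cross = iid_circ_gaussian_cross_moment[OF w v]
  show "integrable M (\<lambda>\<omega>. herm f (w \<omega>))" "expectation (\<lambda>\<omega>. herm f (w \<omega>)) = 0"
    unfolding herm_def using mom by simp_all
  \<comment> \<open>The square is treated as the complex number \<open>z * cnj z\<close>, which can
    be integrated term by term; injectivity of \<open>complex_of_real\<close> brings the result back
    to the reals.\<close>
  have sq: "complex_of_real ((cmod (herm f (w \<omega>)))\<^sup>2) =
      (\<Sum>i\<in>UNIV. \<Sum>j\<in>UNIV. cnj (f $ i) * f $ j * (w \<omega> $ i * cnj (w \<omega> $ j)))" for \<omega>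
    unfolding complex_norm_square herm_def cnj_sum sum_product by (simp add: mult_ac)
  have int: "integrable M (\<lambda>\<omega>. complex_of_real ((cmod (herm f (w \<omega>)))\<^sup>2))"
    unfolding sq using cross(1) by (intro Bochner_Integration.integrable_sum integrable_mult_right)
  have "complex_of_real (expectation (\<lambda>\<omega>. (cmod (herm f (w \<omega>)))\<^sup>2)) =
      expectation (\<lambda>\<omega>. complex_of_real ((cmod (herm f (w \<omega>)))\<^sup>2))"
    by (simp del: of_real_power)
  also have "\<dots> = (\<Sum>i\<in>UNIV. \<Sum>j\<in>UNIV. cnj (f $ i) * f $ j * (if i = j then complex_of_real v else 0))"
    unfolding sq using cross by (simp add: Bochner_Integration.integral_sum)
  also have "\<dots> = (\<Sum>i\<in>UNIV. cnj (f $ i) * f $ i * complex_of_real v)"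
    by (intro sum.cong refl) (simp add: if_distrib[of "\<lambda>x. _ * x"] cong: if_cong)
  also have "\<dots> = complex_of_real (v * (\<Sum>i\<in>UNIV. (cmod (f $ i))\<^sup>2))"
    unfolding of_real_mult of_real_sum complex_norm_square sum_distrib_left
    by (simp add: mult_ac)
  also have "(\<Sum>i\<in>UNIV. (cmod (f $ i))\<^sup>2) = (norm f)\<^sup>2"
    by (rule power2_norm_vec[symmetric])
  finally show "expectation (\<lambda>\<omega>. (cmod (herm f (w \<omega>)))\<^sup>2) = v * (norm f)\<^sup>2"
    by (simp only: of_real_eq_iff)
  show "integrable M (\<lambda>\<omega>. (cmod (herm f (w \<omega>)))\<^sup>2)"
    using integrable_Re[OF int] by simp
qed

text \<open>The cross term is \<open>2 * Re (cnj b * Z \<omega>)\<close>, which is linear in a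
  centred variable and so has mean 0.\<close>

lemma second_moment_shift:
  fixes Z :: "'a \<Rightarrow> complex"
  assumes "integrable M Z" "expectation Z = 0" "integrable M (\<lambda>\<omega>. (cmod (Z \<omega>))\<^sup>2)"
  shows "expectation (\<lambda>\<omega>. (cmod (b + Z \<omega>))\<^sup>2) = (cmod b)\<^sup>2 + expectation (\<lambda>\<omega>. (cmod (Z \<omega>))\<^sup>2)"
proof -
  have "integrable M (\<lambda>\<omega>. Re (Z \<omega>))" "integrable M (\<lambda>\<omega>. Im (Z \<omega>))"
    "expectation (\<lambda>\<omega>. Re (Z \<omega>)) = 0" "expectation (\<lambda>\<omega>. Im (Z \<omega>)) = 0"
    using assms(1,2) by simp_all
  moreover have "(cmod (b + Z \<omega>))\<^sup>2 =
      (cmod b)\<^sup>2 + (cmod (Z \<omega>))\<^sup>2 + (2 * Re b * Re (Z \<omega>) + 2 * Im b * Im (Z \<omega>))" for \<omega>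
    by (simp add: cmod_power2 power2_sum)
  ultimately show ?thesis
    using assms(3) by (simp add: prob_space)
qed

end

section \<open>The two mean squares as functions of the filter\<close>

lemma herm_measurable [measurable]: "herm f \<in> borel_measurable borel"
  unfolding herm_def [abs_def]
  by (intro borel_measurable_continuous_onI continuous_intros)

lemma h_hat_eq: "h_hat x f c n = c * herm f x + herm f n"
  unfolding h_hat_def y_tr_def herm_def
  by (simp add: distrib_left sum.distrib sum_distrib_left mult_ac)

lemma herm_scaleR_self: "herm (a *\<^sub>R x) x = complex_of_real (a * (norm x)\<^sup>2)"
proof -
  have "herm (a *\<^sub>R x) x = complex_of_real a * (\<Sum>i\<in>UNIV. x $ i * cnj (x $ i))"
    unfolding herm_def vector_scaleR_component complex_cnj_scaleR sum_distrib_left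
    by (simp add: scaleR_conv_of_real[where 'a = complex] mult_ac)
  then show ?thesis
    by (simp only: power2_norm_vec of_real_mult of_real_sum complex_norm_square)
qed

context
  fixes M :: "'w measure" and h :: "'w \<Rightarrow> complex" and w :: "'w \<Rightarrow> complex ^ 'b" and vw :: real
  assumes M: "prob_space M" and h [measurable]: "h \<in> borel_measurable M"
    and w [measurable]: "w \<in> borel_measurable M"
    and noise: "iid_circ_gaussian M vw w" and vw: "0 < vw"
    and h2: "integrable M (\<lambda>\<omega>. (cmod (h \<omega>))\<^sup>2)"
begin

interpretation prob_space M by (rule M)

text \<open>The factor \<open>b\<close> is left arbitrary to serve both mean squares: the estimate
  has \<open>b = herm f x\<close>, the error has \<open>b = herm f x - 1\<close>. For a fixed
  channel value \<open>c\<close>, the term \<open>c * b\<close> is a constant shift of centred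
  noise, so the outer integral only sees the square of \<open>cmod c\<close>.\<close>

lemma double_expectation:
  "(\<integral>c. (\<integral>n. (cmod (c * b + herm f n))\<^sup>2 \<partial>distr M borel w) \<partial>distr M borel h) =
    expectation (\<lambda>\<omega>. (cmod (h \<omega>))\<^sup>2) * (cmod b)\<^sup>2 + vw * (norm f)\<^sup>2"
proof -
  have inner: "(\<integral>n. (cmod (c * b + herm f n))\<^sup>2 \<partial>distr M borel w) =
      (cmod c)\<^sup>2 * (cmod b)\<^sup>2 + vw * (norm f)\<^sup>2" for c
    using second_moment_shift[OF herm_noise_moments(1-3)[OF noise vw]] herm_noise_moments(4)[OF noise vw]
    by (simp add: integral_distr norm_mult power_mult_distrib)
  show ?thesis
    unfolding inner using h2 by (simp add: integral_distr prob_space)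
qed

lemma mean_sq_error_eq:
  "mean_sq_error (distr M borel h) (distr M borel w) x f =
    expectation (\<lambda>\<omega>. (cmod (h \<omega>))\<^sup>2) * (cmod (herm f x - 1))\<^sup>2 + vw * (norm f)\<^sup>2"
proof -
  have "h_hat x f c n - c = c * (herm f x - 1) + herm f n" for c n
    by (simp add: h_hat_eq algebra_simps)
  then show ?thesis
    by (simp only: mean_sq_error_def double_expectation)
qed

lemma mean_sq_estimate_eq:
  "mean_sq_estimate (distr M borel h) (distr M borel w) x f =
    expectation (\<lambda>\<omega>. (cmod (h \<omega>))\<^sup>2) * (cmod (herm f x))\<^sup>2 + vw * (norm f)\<^sup>2"
  by (simp only: mean_sq_estimate_def h_hat_eq double_expectation)

section \<open>The objective on the ray through the training vector\<close>

lemma MSE_rc_ZF0_ray: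
  fixes x :: "complex ^ 'b"
  defines "P \<equiv> expectation (\<lambda>\<omega>. (cmod (h \<omega>))\<^sup>2)" and "s \<equiv> (norm x)\<^sup>2"
  assumes "x \<noteq> 0" "0 < vx" "0 < P" "0 < a"
  shows "MSE_rc_ZF0 (distr M borel h) (distr M borel w) x vx vw (a *\<^sub>R x) =
    vx * (1 + ((P + vw / vx) * (1 / a)\<^sup>2 - 2 * P * s * (1 / a)) / (s * (P * s + vw)))"
proof -
  have s: "0 < s" using assms by (simp add: s_def)
  have norm_sq: "(norm (a *\<^sub>R x))\<^sup>2 = a\<^sup>2 * s"
    by (simp add: s_def power_mult_distrib)
  have est: "mean_sq_estimate (distr M borel h) (distr M borel w) x (a *\<^sub>R x) = a\<^sup>2 * (s * (P * s + vw))"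
    unfolding mean_sq_estimate_eq norm_sq herm_scaleR_self P_def[symmetric] s_def[symmetric]
    by (simp only: norm_of_real power2_abs) (simp add: algebra_simps power2_eq_square)
  have "herm (a *\<^sub>R x) x - 1 = complex_of_real (a * s - 1)"
    by (simp add: herm_scaleR_self s_def)
  \<comment> \<open>The error is written as the mean squared estimate plus a remainder; the common
    part becomes the summand 1 of the objective.\<close>
  then have err: "mean_sq_error (distr M borel h) (distr M borel w) x (a *\<^sub>R x) =
      a\<^sup>2 * (s * (P * s + vw)) + P - 2 * P * s * a"
    unfolding mean_sq_error_eq norm_sq P_def[symmetric]
    by (simp only: norm_of_real power2_abs) (simp add: algebra_simps power2_eq_square)
  have pos: "0 < s * (P * s + vw)"
    using s assms vw by (simp add: add_pos_pos)
  \<comment> \<open>Abstracting \<open>s * (P * s + vw)\<close> to a positive \<open>k\<close> keeps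
    the clearing of denominators small.\<close>
  have identity: "(a\<^sup>2 * k + P - 2 * P * s * a) / (a\<^sup>2 * k) * vx + vw / (a\<^sup>2 * k) =
      vx * (1 + ((P + vw / vx) * (1 / a)\<^sup>2 - 2 * P * s * (1 / a)) / k)" if "0 < k" for k
    using that assms(4,6) by (simp add: field_simps power2_eq_square)
  show ?thesis
    unfolding MSE_rc_ZF0_def est err by (rule identity[OF pos])
qed

text \<open>Refuting minimality takes only one strictly better filter, and one is found on the same
  ray, so other directions are never examined.\<close>

lemma ray_not_arg_min:
  fixes x :: "complex ^ 'b"
  defines "P \<equiv> expectation (\<lambda>\<omega>. (cmod (h \<omega>))\<^sup>2)" and "s \<equiv> (norm x)\<^sup>2"
  assumes x: "x \<noteq> 0" and vx: "0 < vx" and P: "0 < P" and a: "0 < a"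
    and neq: "1 / a \<noteq> P * s / (P + vw / vx)"
  shows "\<not> is_arg_min (MSE_rc_ZF0 (distr M borel h) (distr M borel w) x vx vw) (\<lambda>f. f \<noteq> 0) (a *\<^sub>R x)"
proof -
  define Q where "Q = P + vw / vx"
  \<comment> \<open>The reciprocal of the vertex \<open>P * s / Q\<close> of the quadratic.\<close>
  define b where "b = Q / (P * s)"
  have s: "0 < s" using x by (simp add: s_def)
  have Q: "0 < Q" using P vx vw by (simp add: Q_def add_pos_pos)
  have b: "0 < b" using Q P s by (simp add: b_def)
  have k: "0 < s * (P * s + vw)" using s P vw by (simp add: add_pos_pos)
  \<comment> \<open>Completing the square: the excess over the vertex value is \<open>Q\<close>
    times the squared distance to the vertex.\<close>
  have "Q * (1 / a)\<^sup>2 - 2 * P * s * (1 / a) - (Q * (1 / b)\<^sup>2 - 2 * P * s * (1 / b))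
      = Q * (1 / a - P * s / Q)\<^sup>2"
    using Q P s a by (simp add: b_def field_simps power2_eq_square)
  also have "\<dots> > 0" using Q neq by (simp add: Q_def)
  finally have "(Q * (1 / b)\<^sup>2 - 2 * P * s * (1 / b)) / (s * (P * s + vw))
      < (Q * (1 / a)\<^sup>2 - 2 * P * s * (1 / a)) / (s * (P * s + vw))"
    using k by (intro divide_strict_right_mono) auto
  then have "MSE_rc_ZF0 (distr M borel h) (distr M borel w) x vx vw (b *\<^sub>R x)
      < MSE_rc_ZF0 (distr M borel h) (distr M borel w) x vx vw (a *\<^sub>R x)"
    using MSE_rc_ZF0_ray[OF x vx] a b P vx unfolding P_def s_def Q_def by simp
  moreover have "b *\<^sub>R x \<noteq> 0" using b x by simp
  ultimately show ?thesis unfolding is_arg_min_def by blast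
qed

end

theorem proposition2:
  fixes M :: "'w measure"
    and h :: "'w \<Rightarrow> complex"
    and w :: "'w \<Rightarrow> complex ^ 'b"
    and x :: "complex ^ 'b"
    and vx vw :: real
  assumes "prob_space M"
    and "h \<in> borel_measurable M"
    and "w \<in> borel_measurable M"
    and "prob_space.indep_set M (sets (vimage_algebra (space M) h borel))
           (sets (vimage_algebra (space M) w borel))"
    and "iid_circ_gaussian M vw w"
    and "integrable M (\<lambda>\<omega>. (cmod (h \<omega>))\<^sup>2)"
    and "(\<integral>\<omega>. h \<omega> \<partial>M) = 0"
    and "(\<integral>\<omega>. (cmod (h \<omega>))\<^sup>2 \<partial>M) > 0"
    and "x \<noteq> 0"
    and "vx > 0"
    and "vw > 0"
  shows "\<not> is_arg_min (MSE_rc_ZF0 (distr M borel h) (distr M borel w) x vx vw) (\<lambda>f. f \<noteq> 0)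
             (f_MVU x) \<and>
         \<not> is_arg_min (MSE_rc_ZF0 (distr M borel h) (distr M borel w) x vx vw) (\<lambda>f. f \<noteq> 0)
             (f_MMSE (\<integral>\<omega>. (cmod (h \<omega>))\<^sup>2 \<partial>M) vw x)"
proof -
  define P where "P = (\<integral>\<omega>. (cmod (h \<omega>))\<^sup>2 \<partial>M)"
  define s where "s = (norm x)\<^sup>2"
  have pos: "0 < P" "0 < s" "0 < vw / vx"
    using assms by (simp_all add: P_def s_def)
  \<comment> \<open>The vertex is \<open>s\<close> times \<open>P / (P + vw / vx)\<close>, a factor
    below 1; this already excludes MVU, where \<open>1 / a = s\<close>.\<close>
  have opt_less: "P * s / (P + vw / vx) < s"
    using pos mult_pos_pos[OF pos(2,3)] by (simp add: pos_divide_less_eq distrib_left mult.commute)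
  note not_min = ray_not_arg_min[OF assms(1-3,5,11,6,9,10,8), folded P_def s_def]
  have "\<not> is_arg_min (MSE_rc_ZF0 (distr M borel h) (distr M borel w) x vx vw) (\<lambda>f. f \<noteq> 0)
      ((1 / s) *\<^sub>R x)"
    using opt_less pos by (intro not_min) auto
  moreover have "\<not> is_arg_min (MSE_rc_ZF0 (distr M borel h) (distr M borel w) x vx vw) (\<lambda>f. f \<noteq> 0)
      ((P / (P * s + vw)) *\<^sub>R x)"
  proof (rule not_min)
    show "0 < P / (P * s + vw)"
      using pos assms(11) by (simp add: add_pos_pos)
    \<comment> \<open>This reciprocal is \<open>s + vw / P\<close>, so MMSE lies even farther from
      the vertex than MVU, on the same side.\<close>
    have "s < 1 / (P / (P * s + vw))"
      using pos assms(11) by (simp add: field_simps)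
    then show "1 / (P / (P * s + vw)) \<noteq> P * s / (P + vw / vx)"
      using opt_less by linarith
  qed
  ultimately show ?thesis
    by (simp add: f_MVU_def f_MMSE_def P_def s_def)
qed

end
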